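(* For every integer $n\ge 1$, the matrix ring over dual numbers $M_n(\mathbb{D})$ is not strongly regular.
   Context: $\mathbb{D}=\{a+b\epsilon \mid a,b\in\mathbb{R},\ \epsilon^2=0\}$ is the ring of dual numbers, and $M_n(\mathbb{D})$ is the ring of $n\times n$ matrices over $\mathbb{D}$. An element $a$ of a ring $R$ (associative with identity) is strongly regular if $a^2x=a=ya^2$ for some $x,y\in R$. A ring is strongly regular if every element of it is strongly regular. *)

theory Defs
  imports Complex_Main "Jordan_Normal_Form.Matrix"
begin

text \<open>The dual number \<open>a + b\<epsilon>\<close> is represented by its pair of real components.\<close>

datatype dual = Dual (re_part: real) (eps_part: real)

instantiation dual :: comm_ring_1
begin

definition "0 = Dual 0 0"

definition "1 = Dual 1 0"

definition "x + y = Dual (re_part x + re_part y) (eps_part x + eps_part y)"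

definition "x - y = Dual (re_part x - re_part y) (eps_part x - eps_part y)"

definition "- x = Dual (- re_part x) (- eps_part x)"

text \<open>\<open>(a + b\<epsilon>) (c + d\<epsilon>) = ac + (ad + bc)\<epsilon>\<close>, since \<open>\<epsilon>\<^sup>2 = 0\<close>.\<close>

definition "x * y =
  Dual (re_part x * re_part y) (re_part x * eps_part y + eps_part x * re_part y)"

instance
  by standard
    (auto simp: zero_dual_def one_dual_def plus_dual_def minus_dual_def uminus_dual_def
      times_dual_def algebra_simps)

end

definition dual_of_real :: "real \<Rightarrow> dual" where
  "dual_of_real a = Dual a 0"

definition dual_eps :: dual where
  "dual_eps = Dual 0 1"

lemma dual_eps_square: "dual_eps\<^sup>2 = 0"
  by (simp add: dual_eps_def power2_eq_square times_dual_def zero_dual_def)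

lemma Dual_eq: "Dual a b = dual_of_real a + dual_of_real b * dual_eps"
  by (simp add: dual_of_real_def dual_eps_def plus_dual_def times_dual_def)

definition strongly_regular_elem :: "('a, 'b) ring_scheme \<Rightarrow> 'a \<Rightarrow> bool" where
  "strongly_regular_elem R a \<longleftrightarrow>
    (\<exists>x \<in> carrier R. \<exists>y \<in> carrier R.
      a [^]\<^bsub>R\<^esub> (2::nat) \<otimes>\<^bsub>R\<^esub> x = a \<and> a = y \<otimes>\<^bsub>R\<^esub> a [^]\<^bsub>R\<^esub> (2::nat))"

definition strongly_regular_ring :: "('a, 'b) ring_scheme \<Rightarrow> bool" where
  "strongly_regular_ring R \<longleftrightarrow> (\<forall>a \<in> carrier R. strongly_regular_elem R a)"

text \<open>The last argument of \<^const>\<open>ring_mat\<close> only fills the extension slot of the ring record.\<close>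

abbreviation dual_matrix_ring :: "nat \<Rightarrow> dual mat ring" where
  "dual_matrix_ring n \<equiv> ring_mat TYPE(dual) n ()"

lemma ring_dual_matrix_ring: "ring (dual_matrix_ring n)"
  by (rule ring_mat)

end

theory Submission
  imports Defs
begin

text \<open>If \<open>a\<close> squares to zero, strong regularity gives a = a^2 x = 0 x = 0. The
  scalar matrix eps I squares to eps^2 I = 0 yet is nonzero as soon as it has an entry, so it cannot
  be strongly regular.\<close>

text \<open>A strongly regular ring has no nonzero element of square zero, whereas \<open>\<epsilon>I\<close> is such an
  element of the matrix ring.\<close>

lemma (in ring) strongly_regular_elem_square_zero:
  assumes "strongly_regular_elem R a" "a \<in> carrier R" "a \<otimes> a = \<zero>"
  shows "a = \<zero>"
proof -
  have "a [^] (2::nat) = \<zero>"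
    using assms(2,3) by (simp add: numeral_2_eq_2)
  moreover obtain x where "x \<in> carrier R" "a [^] (2::nat) \<otimes> x = a"
    using assms(1) unfolding strongly_regular_elem_def by blast
  ultimately show ?thesis
    by simp
qed

theorem corollary3p3:
  fixes n :: nat
  assumes "n \<ge> 1"
  shows "\<not> strongly_regular_ring (dual_matrix_ring n)"
proof
  assume regular: "strongly_regular_ring (dual_matrix_ring n)"
  let ?A = "dual_eps \<cdot>\<^sub>m 1\<^sub>m n"
  have carrier: "?A \<in> carrier (dual_matrix_ring n)"
    by (simp add: ring_mat_simps)
  \<comment> \<open>Pulling the scalars out of the product leaves eps^2 on the diagonal, which
    vanishes.\<close>
  have "?A * ?A = dual_eps \<cdot>\<^sub>m (1\<^sub>m n * ?A)"
    by (rule mult_smult_assoc_mat[of _ n n _ n]) simp_all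
  also have "1\<^sub>m n * ?A = ?A"
    by (rule left_mult_one_mat[of _ n n]) simp
  also have "dual_eps \<cdot>\<^sub>m ?A = (dual_eps * dual_eps) \<cdot>\<^sub>m 1\<^sub>m n"
    by (rule eq_matI) simp_all
  also have "\<dots> = 0\<^sub>m n n"
    using dual_eps_square by (intro eq_matI) (simp_all add: power2_eq_square)
  finally have square: "?A * ?A = 0\<^sub>m n n" .
  have "strongly_regular_elem (dual_matrix_ring n) ?A"
    using regular carrier unfolding strongly_regular_ring_def by (rule bspec)
  then have "?A = \<zero>\<^bsub>dual_matrix_ring n\<^esub>"
    by (rule ring.strongly_regular_elem_square_zero[OF ring_dual_matrix_ring _ carrier])
      (simp only: ring_mat_simps square)
  \<comment> \<open>The index (0, 0) is in range because \<open>n \<ge> 1\<close>; there the left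
    side is eps = \<open>Dual 0 1\<close> and the right side is \<open>Dual 0 0\<close>.\<close>
  then have "?A $$ (0, 0) = 0\<^sub>m n n $$ (0, 0)"
    by (simp only: ring_mat_simps)
  with assms show False
    by (simp add: dual_eps_def zero_dual_def one_dual_def times_dual_def)
qed

end
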